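(* Let $T\in\mathbb{B}(\mathcal{H})$ be a bounded linear operator on a complex Hilbert space $\mathcal{H}$ and let $\lambda\in(0,1)$. Then the following statements are equivalent: (i) $\|M_\lambda(T)\|=2\max\{\lambda\|T\|,(1-\lambda)\|T^D\|\}$. (ii) $\omega(T^*T^D)=\frac{1}{\lambda-\lambda^2}\max\{\lambda^2\|T\|^2,(1-\lambda)^2\|T^D\|^2\}$.
   Context: $\mathbb{B}(\mathcal{H})$ is the algebra of bounded linear operators on the complex Hilbert space $\mathcal{H}$, $\|\cdot\|$ the operator norm, and $\omega(A)=\sup\{|\langle Ax,x\rangle|:\ x\in\mathcal{H},\ \|x\|=1\}$ is the numerical radius. $T=U|T|$ denotes the canonical polar decomposition: $|T|=(T^*T)^{1/2}$ and $U$ is the unique partial isometry with $T=U|T|$ and $\mathcal{N}(U)=\mathcal{N}(T)$ (null spaces). The Duggal transform of $T$ is $T^D:=|T|U$. For $\lambda\in[0,1]$ the $\lambda$-mean transform of $T$ is $M_\lambda(T):=\lambda T+(1-\lambda)T^D$. *)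

theory Defs
  imports "HOL-Analysis.Analysis"
begin

text \<open>Building on \<^class>\<open>real_normed_vector\<close> makes \<^const>\<open>bounded_linear\<close>, \<^const>\<open>onorm\<close> and the
  metric topology available; \<open>scaleR_scaleC\<close> and \<open>norm_eq_sqrt_cinner\<close> tie the real scalar
  multiplication and the norm to the complex structure. The inner product is linear in its
  first argument.\<close>

class complex_inner = real_normed_vector +
  fixes scaleC :: "complex \<Rightarrow> 'a \<Rightarrow> 'a"  (infixr \<open>*\<^sub>C\<close> 75)
    and cinner :: "'a \<Rightarrow> 'a \<Rightarrow> complex"
  assumes scaleC_add_right: "a *\<^sub>C (x + y) = a *\<^sub>C x + a *\<^sub>C y"
    and scaleC_add_left: "(a + b) *\<^sub>C x = a *\<^sub>C x + b *\<^sub>C x"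
    and scaleC_scaleC: "a *\<^sub>C (b *\<^sub>C x) = (a * b) *\<^sub>C x"
    and scaleR_scaleC: "r *\<^sub>R x = complex_of_real r *\<^sub>C x"
    and cinner_commute: "cinner x y = cnj (cinner y x)"
    and cinner_add_left: "cinner (x + y) z = cinner x z + cinner y z"
    and cinner_scaleC_left: "cinner (a *\<^sub>C x) y = a * cinner x y"
    and cinner_ge_zero: "cinner x x \<in> \<real>\<^sub>\<ge>\<^sub>0"
    and cinner_eq_zero_iff: "cinner x x = 0 \<longleftrightarrow> x = 0"
    and norm_eq_sqrt_cinner: "norm x = sqrt (Re (cinner x x))"

class chilbert_space = complex_inner + complete_space

instantiation complex :: chilbert_space
begin

definition scaleC_complex :: "complex \<Rightarrow> complex \<Rightarrow> complex"
  where "scaleC_complex a x = a * x"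

definition cinner_complex :: "complex \<Rightarrow> complex \<Rightarrow> complex"
  where "cinner_complex x y = x * cnj y"

instance
  by standard
    (auto simp: scaleC_complex_def cinner_complex_def algebra_simps scaleR_conv_of_real
      complex_nonneg_Reals_iff cmod_def power2_eq_square)

end

definition bounded_clinear :: "('a::complex_inner \<Rightarrow> 'a) \<Rightarrow> bool"
  where "bounded_clinear T \<longleftrightarrow> bounded_linear T \<and> (\<forall>c x. T (c *\<^sub>C x) = c *\<^sub>C T x)"

definition cadjoint :: "('a::chilbert_space \<Rightarrow> 'a) \<Rightarrow> 'a \<Rightarrow> 'a"
  where "cadjoint T = (THE S. \<forall>x y. cinner (T x) y = cinner x (S y))"

text \<open>Over complex scalars, nonnegativity of the quadratic form already forces self-adjointness.\<close>

definition positive_op :: "('a::complex_inner \<Rightarrow> 'a) \<Rightarrow> bool"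
  where "positive_op P \<longleftrightarrow> bounded_clinear P \<and> (\<forall>x. cinner (P x) x \<in> \<real>\<^sub>\<ge>\<^sub>0)"

definition sqrt_op :: "('a::chilbert_space \<Rightarrow> 'a) \<Rightarrow> 'a \<Rightarrow> 'a"
  where "sqrt_op A = (THE P. positive_op P \<and> P \<circ> P = A)"

definition abs_op :: "('a::chilbert_space \<Rightarrow> 'a) \<Rightarrow> 'a \<Rightarrow> 'a"
  where "abs_op T = sqrt_op (cadjoint T \<circ> T)"

definition null_space :: "('a::complex_inner \<Rightarrow> 'a) \<Rightarrow> 'a set"
  where "null_space T = {x. T x = 0}"

definition corthogonal :: "'a::complex_inner set \<Rightarrow> 'a set"
  where "corthogonal S = {x. \<forall>y\<in>S. cinner x y = 0}"

definition partial_isometry :: "('a::chilbert_space \<Rightarrow> 'a) \<Rightarrow> bool"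
  where "partial_isometry U \<longleftrightarrow>
    bounded_clinear U \<and> (\<forall>x\<in>corthogonal (null_space U). norm (U x) = norm x)"

definition polar_isometry :: "('a::chilbert_space \<Rightarrow> 'a) \<Rightarrow> 'a \<Rightarrow> 'a"
  where "polar_isometry T =
    (THE U. partial_isometry U \<and> T = U \<circ> abs_op T \<and> null_space U = null_space T)"

definition duggal_transform :: "('a::chilbert_space \<Rightarrow> 'a) \<Rightarrow> 'a \<Rightarrow> 'a"
  where "duggal_transform T = abs_op T \<circ> polar_isometry T"

definition mean_transform :: "real \<Rightarrow> ('a::chilbert_space \<Rightarrow> 'a) \<Rightarrow> 'a \<Rightarrow> 'a"
  where "mean_transform l T = (\<lambda>x. l *\<^sub>R T x + (1 - l) *\<^sub>R duggal_transform T x)"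

text \<open>Inserting \<open>0\<close> only matters on the zero space, which has no unit vectors: there the supremum
  (of nonnegative reals) over the empty set is \<open>0\<close>, whereas \<^term>\<open>Sup {} :: real\<close> is unspecified.\<close>

definition numerical_radius :: "('a::complex_inner \<Rightarrow> 'a) \<Rightarrow> real"
  where "numerical_radius A = Sup (insert 0 {cmod (cinner (A x) x) | x. norm x = 1})"

end

theory Submission
  imports Defs
begin

text \<open>Put \<open>M = max (\<lambda>\<parallel>T\<parallel>) ((1 - \<lambda>)\<parallel>T\<^sup>D\<parallel>)\<close>. Expanding \<open>\<parallel>\<lambda>T x + (1 - \<lambda>)T\<^sup>D x\<parallel>\<^sup>2\<close> bounds the square of
  the norm of the mean transform by \<open>2M\<^sup>2 + 2\<lambda>(1 - \<lambda>) \<omega>(T\<^sup>*T\<^sup>D)\<close>, so norm \<open>2M\<close> forces the numerical radius to be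
  maximal. Conversely, unit vectors \<open>x\<close> along which \<open>|\<langle>T\<^sup>D x, T x\<rangle>|\<close> approaches its maximum are
  norming for both \<open>T\<close> and \<open>T\<^sup>D\<close>, and positivity of \<open>|T|\<close> forces \<open>\<langle>T\<^sup>D x, T x\<rangle>\<close> to be asymptotically
  nonnegative, so that the two summands add up without cancellation.\<close>

text \<open>The adjoint, the square root and the polar factor are definite descriptions, so nothing
  can be said about \<open>duggal_transform\<close> before existence and uniqueness of each are
  known. One estimate recurs: \<open>norm (P x)^2 <= onorm P * Re (cinner (P x) x)\<close> for
  positive P. It makes the starting point of the square root iteration a contraction, makes positive
  square roots unique, and turns almost norming vectors of |T| into approximate eigenvectors.

  Since w(T* T^D) <= |T| |T^D| in norms, l (1 - l) w(T* T^D) never exceeds M^2, and (ii) says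
  exactly that this ceiling is reached. For M > 0 this forces both l |T| and (1 - l) |T^D| to equal
  M. For two unrelated operators A, B the analogous equivalence fails: B = -A with l = 1/2 has the
  maximal radius of A* B, but the mean is 0. Hence the polar structure must enter in the converse.
  Suprema need not be attained, so that direction runs along sequences of unit vectors.\<close>

instance chilbert_space \<subseteq> banach ..

section \<open>Complex inner products\<close>

lemma cinner_zero_left [simp]: "cinner 0 y = 0" for y :: "'a::complex_inner"
  using cinner_add_left[of 0 0 y] by simp

lemma cinner_minus_left: "cinner (- x) y = - cinner x y" for x y :: "'a::complex_inner"
  using cinner_add_left[of "- x" x y] by (simp add: add_eq_0_iff)

lemma cinner_diff_left: "cinner (x - y) z = cinner x z - cinner y z"
  for x y z :: "'a::complex_inner"
  using cinner_add_left[of x "- y" z] by (simp add: cinner_minus_left)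

lemma cinner_add_right: "cinner x (y + z) = cinner x y + cinner x z"
  for x y z :: "'a::complex_inner"
  by (metis cinner_add_left cinner_commute complex_cnj_add)

lemma cinner_zero_right [simp]: "cinner x 0 = 0" for x :: "'a::complex_inner"
  by (metis cinner_commute cinner_zero_left complex_cnj_zero)

lemma cinner_diff_right: "cinner x (y - z) = cinner x y - cinner x z"
  for x y z :: "'a::complex_inner"
  by (metis cinner_diff_left cinner_commute complex_cnj_diff)

lemma cinner_scaleC_right: "cinner x (c *\<^sub>C y) = cnj c * cinner x y"
  for x y :: "'a::complex_inner"
  by (metis cinner_scaleC_left cinner_commute complex_cnj_mult)

lemma cinner_scaleR_left: "cinner (r *\<^sub>R x) y = of_real r * cinner x y"
  for x y :: "'a::complex_inner"
  by (simp add: scaleR_scaleC cinner_scaleC_left)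

lemma cinner_scaleR_right: "cinner x (r *\<^sub>R y) = of_real r * cinner x y"
  for x y :: "'a::complex_inner"
  by (simp add: scaleR_scaleC cinner_scaleC_right)

lemma cinner_self: "cinner x x = complex_of_real ((norm x)\<^sup>2)" for x :: "'a::complex_inner"
  using cinner_ge_zero[of x] unfolding complex_nonneg_Reals_iff norm_eq_sqrt_cinner[of x]
  by (simp add: complex_eqI)

lemmas cinner_simps = cinner_add_left cinner_add_right cinner_diff_left cinner_diff_right
  cinner_scaleC_left cinner_scaleC_right cinner_scaleR_left cinner_scaleR_right

lemma Re_cinner_commute: "Re (cinner x y) = Re (cinner y x)" for x y :: "'a::complex_inner"
  by (simp add: cinner_commute[of x y])

lemma norm_add_sq: "(norm (x + y))\<^sup>2 = (norm x)\<^sup>2 + (norm y)\<^sup>2 + 2 * Re (cinner x y)"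
  for x y :: "'a::complex_inner"
proof -
  have "cinner (x + y) (x + y) = cinner x x + cinner y y + (cinner x y + cinner y x)"
    by (simp add: cinner_simps)
  from arg_cong[OF this, of Re] show ?thesis
    by (simp add: cinner_self Re_cinner_commute[of y x])
qed

lemma norm_diff_sq: "(norm (x - y))\<^sup>2 = (norm x)\<^sup>2 + (norm y)\<^sup>2 - 2 * Re (cinner x y)"
  for x y :: "'a::complex_inner"
  using norm_add_sq[of x "- y"] cinner_diff_right[of x 0 y] by simp

lemma norm_scaleC: "norm (c *\<^sub>C x) = cmod c * norm x" for x :: "'a::complex_inner"
proof -
  have "cinner (c *\<^sub>C x) (c *\<^sub>C x) = (c * cnj c) * cinner x x"
    by (simp add: cinner_simps)
  also have "\<dots> = of_real ((cmod c * norm x)\<^sup>2)"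
    by (simp only: cinner_self complex_norm_square[symmetric] power_mult_distrib of_real_mult)
  finally have "(norm (c *\<^sub>C x))\<^sup>2 = (cmod c * norm x)\<^sup>2"
    unfolding cinner_self by (simp only: of_real_eq_iff)
  then show ?thesis
    by simp
qed

lemma bounded_linear_scaleC: "bounded_linear ((*\<^sub>C) c :: 'a::complex_inner \<Rightarrow> 'a)"
  by (rule bounded_linear_intro[where K = "cmod c"])
    (simp_all add: scaleC_add_right scaleR_scaleC scaleC_scaleC norm_scaleC mult.commute)

section \<open>Positive operators\<close>

lemma bounded_clinearD:
  assumes "bounded_clinear T"
  shows "bounded_linear T" "T (c *\<^sub>C x) = c *\<^sub>C T x" "T (x + y) = T x + T y"
    "T (x - y) = T x - T y" "T (r *\<^sub>R x) = r *\<^sub>R T x" "T 0 = 0"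
proof -
  have "bounded_linear T" and "\<And>c x. T (c *\<^sub>C x) = c *\<^sub>C T x"
    using assms by (simp_all only: bounded_clinear_def)
  then show "bounded_linear T" "T (c *\<^sub>C x) = c *\<^sub>C T x" "T (x + y) = T x + T y"
    "T (x - y) = T x - T y" "T (r *\<^sub>R x) = r *\<^sub>R T x" "T 0 = 0"
    by (simp_all only: linear_simps linear_0 bounded_linear.linear)
qed

lemma positive_op_cinner:
  assumes "positive_op P"
  shows "cinner (P x) x = of_real (Re (cinner (P x) x))" "Re (cinner (P x) x) \<ge> 0"
  using assms unfolding positive_op_def by (auto simp: complex_nonneg_Reals_iff complex_eq_iff)

text \<open>Polarization: since the quadratic form is real, its value at x + y controls the
  imaginary parts of the mixed terms, and its value at x + i y the real parts.\<close>

lemma positive_op_selfadjoint: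
  assumes "positive_op P"
  shows "cinner (P x) y = cinner x (P y)"
proof -
  have P: "bounded_clinear P"
    using assms by (simp add: positive_op_def)
  have real: "Im (cinner (P z) z) = 0" for z
    using positive_op_cinner(1)[OF assms, of z] by (metis Im_complex_of_real)
  have "Im (cinner (P x) y) + Im (cinner (P y) x) = 0"
    using real[of "x + y"] real[of x] real[of y]
    by (simp add: bounded_clinearD[OF P] cinner_simps)
  moreover have "Re (cinner (P x) y) = Re (cinner (P y) x)"
    using real[of "x + \<i> *\<^sub>C y"] real[of x] real[of y]
    by (simp add: bounded_clinearD[OF P] cinner_simps)
  ultimately have "cinner (P x) y = cnj (cinner (P y) x)"
    by (simp add: complex_eq_iff)
  then show ?thesis
    by (metis cinner_commute)
qed

text \<open>The form is evaluated at x - t f y with t real; the factor f = <P x, y> aligns the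
  phases and leaves a real quadratic in t. The form may be degenerate, so b = 0 needs its own
  argument.\<close>

lemma positive_op_Cauchy_Schwarz:
  assumes "positive_op P"
  shows "(cmod (cinner (P x) y))\<^sup>2 \<le> Re (cinner (P x) x) * Re (cinner (P y) y)"
proof -
  define f where "f = cinner (P x) y"
  define m where "m = (cmod f)\<^sup>2"
  define a where "a = Re (cinner (P x) x)"
  define b where "b = Re (cinner (P y) y)"
  have P: "bounded_clinear P"
    using assms by (simp add: positive_op_def)
  have ff: "f * cnj f = of_real m" "cnj f * f = of_real m"
    unfolding m_def complex_norm_square by simp_all
  have quad: "0 \<le> a - 2 * t * m + t\<^sup>2 * m * b" for t
  proof -
    define c where "c = of_real t * f"
    have yx: "cinner (P y) x = cnj f"
      by (metis f_def cinner_commute positive_op_selfadjoint[OF assms])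
    have "cinner (P (x - c *\<^sub>C y)) (x - c *\<^sub>C y)
      = cinner (P x) x - cnj c * f - c * cnj f + c * cnj c * cinner (P y) y"
      by (simp add: bounded_clinearD[OF P] cinner_simps yx f_def[symmetric] algebra_simps)
    also have "\<dots> = of_real a - of_real t * (cnj f * f) - of_real t * (f * cnj f)
        + (of_real t)\<^sup>2 * (f * cnj f) * of_real b"
      using positive_op_cinner(1)[OF assms, of x] positive_op_cinner(1)[OF assms, of y]
      by (simp add: a_def b_def c_def power2_eq_square algebra_simps)
    also have "\<dots> = of_real (a - 2 * t * m + t\<^sup>2 * m * b)"
      by (simp add: ff)
    finally show ?thesis
      using positive_op_cinner(2)[OF assms, of "x - c *\<^sub>C y"] by (metis Re_complex_of_real)
  qed
  have b0: "b \<ge> 0"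
    using positive_op_cinner(2)[OF assms] by (simp add: b_def)
  have "m \<le> a * b"
  proof (cases "b = 0")
    case True
    have "m = 0"
    proof (rule ccontr)
      assume "m \<noteq> 0"
      then show False
        \<comment> \<open>For b = 0 the quadratic is affine in t, and this t gives it the value
          -1.\<close>
        using quad[of "(a + 1) / (2 * m)"] True by (simp add: field_simps)
    qed
    then show ?thesis
      using True by simp
  next
    case False
    then show ?thesis
      \<comment> \<open>The minimizer of the quadratic, where its value is a - m / b.\<close>
      using quad[of "1 / b"] b0 by (simp add: field_simps power2_eq_square)
  qed
  then show ?thesis
    by (simp add: m_def a_def b_def f_def)
qed

lemma bounded_clinear_id: "bounded_clinear (\<lambda>x. x)"
  by (simp add: bounded_clinear_def)

lemma cinner_Cauchy_Schwarz: "cmod (cinner x y) \<le> norm x * norm y" for x y :: "'a::complex_inner"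
proof -
  have "positive_op (\<lambda>x::'a. x)"
    by (simp add: positive_op_def bounded_clinear_id cinner_ge_zero)
  from positive_op_Cauchy_Schwarz[OF this, of x y]
  have "(cmod (cinner x y))\<^sup>2 \<le> (norm x * norm y)\<^sup>2"
    unfolding cinner_self power_mult_distrib Re_complex_of_real .
  then show ?thesis
    by (rule power2_le_imp_le) simp
qed

lemma bounded_bilinear_cinner:
  "bounded_bilinear (cinner :: 'a::complex_inner \<Rightarrow> 'a \<Rightarrow> complex)"
proof
  show "\<exists>K. \<forall>a b. cmod (cinner a b) \<le> norm (a::'a) * norm (b::'a) * K"
    by (intro exI[of _ 1]) (simp add: cinner_Cauchy_Schwarz)
qed (simp_all add: cinner_simps scaleR_conv_of_real)

lemmas tendsto_cinner [tendsto_intros] = bounded_bilinear.tendsto[OF bounded_bilinear_cinner]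

text \<open>Cauchy-Schwarz for the form of P with y = P x bounds the fourth power of
  \<open>norm (P x)\<close> by <P x, x> <P (P x), P x>, and the last factor is at most
  \<open>onorm P * norm (P x)^2\<close>. In particular a vanishing form at x forces P x = 0.\<close>

lemma positive_op_norm_sq_le:
  assumes "positive_op P"
  shows "(norm (P x))\<^sup>2 \<le> onorm P * Re (cinner (P x) x)"
proof (cases "P x = 0")
  case False
  have P: "bounded_linear P"
    using assms by (simp add: positive_op_def bounded_clinear_def)
  let ?n = "norm (P x)"
  have n0: "?n\<^sup>2 > 0"
    using False by simp
  have "Re (cinner (P (P x)) (P x)) \<le> norm (P (P x)) * ?n"
    using complex_Re_le_cmod cinner_Cauchy_Schwarz order_trans by blast
  also have "\<dots> \<le> onorm P * ?n * ?n"
    by (intro mult_right_mono onorm[OF P]) simp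
  finally have "Re (cinner (P (P x)) (P x)) \<le> onorm P * ?n\<^sup>2"
    by (simp add: power2_eq_square)
  then have "Re (cinner (P x) x) * Re (cinner (P (P x)) (P x))
      \<le> Re (cinner (P x) x) * (onorm P * ?n\<^sup>2)"
    by (rule mult_left_mono) (rule positive_op_cinner(2)[OF assms])
  moreover have "(?n\<^sup>2)\<^sup>2 \<le> Re (cinner (P x) x) * Re (cinner (P (P x)) (P x))"
    using positive_op_Cauchy_Schwarz[OF assms, of x "P x"]
    unfolding cinner_self norm_of_real by simp
  ultimately have "?n\<^sup>2 * ?n\<^sup>2 \<le> (onorm P * Re (cinner (P x) x)) * ?n\<^sup>2"
    by (simp add: power2_eq_square algebra_simps)
  then show ?thesis
    using n0 by (simp only: mult_le_cancel_right)
qed (simp add: cinner_simps)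

section \<open>Orthogonal projection and adjoints\<close>

lemma parallelogram_law:
  "(norm (x + y))\<^sup>2 + (norm (x - y))\<^sup>2 = 2 * (norm x)\<^sup>2 + 2 * (norm y)\<^sup>2"
  for x y :: "'a::complex_inner"
  by (simp add: norm_add_sq norm_diff_sq)

lemma ex_orthogonal_projection:
  fixes M :: "'a::chilbert_space set"
  assumes "closed M" and zero: "0 \<in> M"
    and add: "\<And>x y. x \<in> M \<Longrightarrow> y \<in> M \<Longrightarrow> x + y \<in> M"
    and scale: "\<And>c x. x \<in> M \<Longrightarrow> c *\<^sub>C x \<in> M"
  shows "\<exists>y\<in>M. \<forall>z\<in>M. cinner (w - y) z = 0"
proof -
  define d where "d = Inf ((\<lambda>y. (norm (w - y))\<^sup>2) ` M)"
  have bdd: "bdd_below ((\<lambda>y. (norm (w - y))\<^sup>2) ` M)"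
    by (intro bdd_belowI[of _ 0]) auto
  have d_le: "d \<le> (norm (w - y))\<^sup>2" if "y \<in> M" for y
    unfolding d_def by (intro cInf_lower bdd imageI that)
  have "\<exists>y\<in>M. (norm (w - y))\<^sup>2 < d + inverse (real (Suc n))" for n
  proof -
    have "Inf ((\<lambda>y. (norm (w - y))\<^sup>2) ` M) < d + inverse (real (Suc n))"
      unfolding d_def[symmetric] by simp
    then show ?thesis
      using zero by (subst (asm) cInf_less_iff) (auto intro: bdd)
  qed
  then obtain Y where YM: "\<And>n. Y n \<in> M"
    and Y: "\<And>n. (norm (w - Y n))\<^sup>2 < d + inverse (real (Suc n))"
    by metis
  \<comment> \<open>The midpoint of \<open>Y m\<close> and \<open>Y n\<close> lies in M, hence at
    squared distance at least d from w; the parallelogram law then leaves only the two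
    errors.\<close>
  have close: "(norm (Y m - Y n))\<^sup>2 \<le> 2 * inverse (real (Suc m)) + 2 * inverse (real (Suc n))"
    for m n
  proof -
    have "(1/2) *\<^sub>R (Y m + Y n) \<in> M"
      unfolding scaleR_scaleC by (intro scale add YM)
    from d_le[OF this] have "4 * d \<le> (2 * norm (w - (1/2) *\<^sub>R (Y m + Y n)))\<^sup>2"
      by (simp add: power_mult_distrib)
    also have "2 * norm (w - (1/2) *\<^sub>R (Y m + Y n)) = norm (2 *\<^sub>R (w - (1/2) *\<^sub>R (Y m + Y n)))"
      by simp
    also have "2 *\<^sub>R (w - (1/2) *\<^sub>R (Y m + Y n)) = (w - Y m) + (w - Y n)"
      by (simp add: algebra_simps scaleR_2)
    finally have "4 * d \<le> (norm ((w - Y m) + (w - Y n)))\<^sup>2" .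
    moreover have "norm ((w - Y m) - (w - Y n)) = norm (Y m - Y n)"
      by (simp add: norm_minus_commute)
    ultimately show ?thesis
      using parallelogram_law[of "w - Y m" "w - Y n"] Y[of m] Y[of n] by simp
  qed
  have "Cauchy Y"
  proof (rule metric_CauchyI)
    fix e :: real
    assume e: "e > 0"
    then obtain N where N: "inverse (real (Suc N)) < e\<^sup>2 / 4"
      using reals_Archimedean[of "e\<^sup>2 / 4"] by auto
    have "dist (Y m) (Y n) < e" if "m \<ge> N" "n \<ge> N" for m n
    proof -
      have "inverse (real (Suc m)) \<le> inverse (real (Suc N))"
        "inverse (real (Suc n)) \<le> inverse (real (Suc N))"
        using that by (auto intro!: le_imp_inverse_le)
      then have "(norm (Y m - Y n))\<^sup>2 < e\<^sup>2"
        using close[of m n] N by linarith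
      then show ?thesis
        using e by (auto simp: dist_norm intro: power2_less_imp_less)
    qed
    then show "\<exists>N. \<forall>m\<ge>N. \<forall>n\<ge>N. dist (Y m) (Y n) < e"
      by blast
  qed
  then obtain y where lim: "Y \<longlonglongrightarrow> y"
    using Cauchy_convergent convergent_def by blast
  have yM: "y \<in> M"
    using closed_sequentially[OF \<open>closed M\<close>] YM lim by blast
  have "(\<lambda>n. (norm (w - Y n))\<^sup>2) \<longlonglongrightarrow> (norm (w - y))\<^sup>2"
    by (intro tendsto_intros lim)
  moreover have "(\<lambda>n. d + inverse (real (Suc n))) \<longlonglongrightarrow> d + 0"
    by (intro tendsto_intros LIMSEQ_inverse_real_of_nat)
  ultimately have y_le: "(norm (w - y))\<^sup>2 \<le> d"
    using Y by (intro LIMSEQ_le[where X = "\<lambda>n. (norm (w - Y n))\<^sup>2"]) (auto intro: less_imp_le)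
  have "cinner (w - y) z = 0" if z: "z \<in> M" for z
  proof (cases "z = 0")
    case False
    define f where "f = cinner (w - y) z"
    \<comment> \<open>The coefficient of w - y along z. Moving y by c z stays in M and lowers the
      squared distance by |f|^2 / |z|^2, which minimality forbids unless f = 0.\<close>
    define c where "c = f / of_real ((norm z)\<^sup>2)"
    have n0: "(norm z)\<^sup>2 > 0"
      using False by simp
    have "(norm (w - y))\<^sup>2 \<le> (norm (w - (y + c *\<^sub>C z)))\<^sup>2"
      using y_le d_le[of "y + c *\<^sub>C z"] add[OF yM scale[OF z]] by (meson order_trans)
    also have "w - (y + c *\<^sub>C z) = (w - y) - c *\<^sub>C z"
      by simp
    also have "(norm \<dots>)\<^sup>2 = (norm (w - y))\<^sup>2 + (cmod c * norm z)\<^sup>2 - 2 * Re (cnj c * f)"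
      by (simp only: norm_diff_sq norm_scaleC cinner_scaleC_right f_def)
    also have "Re (cnj c * f) = (cmod f)\<^sup>2 / (norm z)\<^sup>2"
    proof -
      have "cnj c * f = of_real ((cmod f)\<^sup>2 / (norm z)\<^sup>2)"
        unfolding c_def of_real_divide complex_norm_square[of f] by simp
      then show ?thesis
        by simp
    qed
    also have "(cmod c * norm z)\<^sup>2 = (cmod f)\<^sup>2 / (norm z)\<^sup>2"
    proof -
      have "cmod c * norm z = cmod f / norm z"
        unfolding c_def norm_divide norm_of_real using False by (simp add: power2_eq_square)
      then show ?thesis
        by (simp add: power_divide)
    qed
    finally have "(cmod f)\<^sup>2 / (norm z)\<^sup>2 \<le> 0"
      by simp
    then have "f = 0"
      using n0 by (simp add: divide_le_0_iff)
    then show ?thesis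
      by (simp add: f_def)
  qed simp
  then show ?thesis
    using yM by blast
qed

lemma Riesz_representation:
  fixes f :: "'a::chilbert_space \<Rightarrow> complex"
  assumes f: "bounded_linear f" and scale: "\<And>c x. f (c *\<^sub>C x) = c * f x"
  shows "\<exists>v. \<forall>x. f x = cinner x v"
proof (cases "\<forall>x. f x = 0")
  case True
  then show ?thesis
    by (intro exI[of _ 0]) simp
next
  case False
  then obtain w where w: "f w \<noteq> 0"
    by blast
  interpret f: bounded_linear f by fact
  have "closed {x. f x = 0}"
    by (intro closed_Collect_eq f.continuous_on continuous_intros)
  then obtain y where y: "f y = 0" and orth: "\<And>z. f z = 0 \<Longrightarrow> cinner (w - y) z = 0"
    using ex_orthogonal_projection[of "{x. f x = 0}" w] by (auto simp: f.add f.zero scale)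
  define u where "u = w - y"
  have fu: "f u = f w"
    by (simp add: u_def f.diff y)
  then have "u \<noteq> 0"
    using w f.zero by auto
  then have uu: "cinner u u \<noteq> 0"
    by (simp add: cinner_eq_zero_iff)
  have "f x = cinner x (cnj (f u / cinner u u) *\<^sub>C u)" for x
  proof -
    \<comment> \<open>Subtracting this multiple of u puts x into the kernel of f, to which u is
      orthogonal.\<close>
    have "f (x - (f x / f u) *\<^sub>C u) = 0"
      using w fu by (simp add: f.diff scale)
    then have "cinner u (x - (f x / f u) *\<^sub>C u) = 0"
      using orth u_def by blast
    then have "cinner (x - (f x / f u) *\<^sub>C u) u = 0"
      by (metis cinner_commute complex_cnj_zero)
    then show ?thesis
      using w fu uu by (simp add: cinner_simps field_simps)
  qed
  then show ?thesis
    by blast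
qed

lemma cinner_left_ext:
  fixes u v :: "'a::complex_inner"
  assumes "\<And>x. cinner x u = cinner x v"
  shows "u = v"
  using assms[of "u - v"] cinner_eq_zero_iff[of "u - v"] by (simp add: cinner_diff_right)

text \<open>Unfolds the definite description: Riesz gives a candidate value for each y, and
  \<open>cinner_left_ext\<close> shows that no other function has the property.\<close>

lemma cinner_cadjoint:
  assumes T: "bounded_clinear T"
  shows "cinner (T x) y = cinner x (cadjoint T y)"
proof -
  have "\<exists>v. \<forall>x. cinner (T x) y = cinner x v" for y
  proof (rule Riesz_representation)
    show "bounded_linear (\<lambda>x. cinner (T x) y)"
      by (rule bounded_linear_compose[OF
            bounded_bilinear.bounded_linear_left[OF bounded_bilinear_cinner] bounded_clinearD(1)[OF T]])
  qed (simp add: bounded_clinearD[OF T] cinner_simps)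
  then obtain S where S: "\<And>x y. cinner (T x) y = cinner x (S y)"
    by metis
  have "\<exists>!S. \<forall>x y. cinner (T x) y = cinner x (S y)"
  proof (rule ex1I[of _ S])
    fix S'
    assume "\<forall>x y. cinner (T x) y = cinner x (S' y)"
    then have eq: "cinner x (S' y) = cinner x (S y)" for x y
      using S by metis
    show "S' = S"
      by (rule ext, rule cinner_left_ext, rule eq)
  qed (simp add: S)
  from theI'[OF this] show ?thesis
    unfolding cadjoint_def by blast
qed

lemma bounded_clinear_cadjoint:
  assumes T: "bounded_clinear T"
  shows "bounded_clinear (cadjoint T)"
  unfolding bounded_clinear_def
proof (intro conjI allI)
  show scale: "cadjoint T (c *\<^sub>C x) = c *\<^sub>C cadjoint T x" for c x
    by (rule cinner_left_ext) (simp only: cinner_cadjoint[OF T, symmetric] cinner_simps)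
  show "bounded_linear (cadjoint T)"
  proof
    show "cadjoint T (x + y) = cadjoint T x + cadjoint T y" for x y
      by (rule cinner_left_ext) (simp only: cinner_cadjoint[OF T, symmetric] cinner_simps)
    show "cadjoint T (r *\<^sub>R x) = r *\<^sub>R cadjoint T x" for r x
      by (simp only: scaleR_scaleC scale)
    have "norm (cadjoint T y) \<le> norm y * onorm T" for y
    proof (cases "cadjoint T y = 0")
      case False
      let ?v = "cadjoint T y"
      \<comment> \<open>The defining identity is tested at x = T* y itself.\<close>
      have "(norm ?v)\<^sup>2 = cmod (cinner (T ?v) y)"
        by (simp only: cinner_cadjoint[OF T] cinner_self norm_of_real) simp
      also have "\<dots> \<le> onorm T * norm ?v * norm y"
        by (intro order_trans[OF cinner_Cauchy_Schwarz] mult_right_mono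
            onorm bounded_clinearD(1)[OF T]) simp
      finally have "norm ?v * norm ?v \<le> norm ?v * (norm y * onorm T)"
        by (simp add: power2_eq_square mult_ac)
      then show ?thesis
        using False by (simp only: mult_le_cancel_left) simp
    qed (simp add: onorm_pos_le[OF bounded_clinearD(1)[OF T]])
    then show "\<exists>K. \<forall>x. norm (cadjoint T x) \<le> norm x * K"
      by blast
  qed
qed

section \<open>Square roots of positive operators\<close>

text \<open>A fixed point \<open>Y\<close> of \<open>Y \<mapsto> (B + Y\<^sup>2) / 2\<close> satisfies \<open>(1 - Y)\<^sup>2 = 1 - B\<close>.\<close>

primrec sqrt_iter :: "('a::real_normed_vector \<Rightarrow>\<^sub>L 'a) \<Rightarrow> nat \<Rightarrow> 'a \<Rightarrow>\<^sub>L 'a"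
  where "sqrt_iter B 0 = 0"
  | "sqrt_iter B (Suc n) = (1/2) *\<^sub>R (B + (sqrt_iter B n o\<^sub>L sqrt_iter B n))"

text \<open>The scalar iteration with \<open>B = 1\<close>, which majorises \<^const>\<open>sqrt_iter\<close> in norm.\<close>

primrec sqrt_majorant :: "nat \<Rightarrow> real"
  where "sqrt_majorant 0 = 0"
  | "sqrt_majorant (Suc n) = (1 + (sqrt_majorant n)\<^sup>2) / 2"

lemma sqrt_majorant_bounds: "0 \<le> sqrt_majorant n" "sqrt_majorant n \<le> 1"
proof -
  have "0 \<le> sqrt_majorant n \<and> sqrt_majorant n \<le> 1"
  proof (induction n)
    case (Suc n)
    then have "(sqrt_majorant n)\<^sup>2 \<le> 1"
      by (simp add: power_le_one)
    then show ?case
      by simp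
  qed simp
  then show "0 \<le> sqrt_majorant n" "sqrt_majorant n \<le> 1"
    by auto
qed

text \<open>The increment of the scalar iteration is (1 - s)^2 / 2.\<close>

lemma sqrt_majorant_mono: "sqrt_majorant n \<le> sqrt_majorant (Suc n)"
  using zero_le_power2[of "1 - sqrt_majorant n"] by (simp add: power2_diff)

lemma summable_sqrt_majorant_diff: "summable (\<lambda>n. sqrt_majorant (Suc n) - sqrt_majorant n)"
proof -
  have "incseq sqrt_majorant"
    by (rule incseq_SucI) (rule sqrt_majorant_mono)
  then have "convergent sqrt_majorant"
    using sqrt_majorant_bounds(2) by (metis convergentI incseq_convergent)
  then show ?thesis
    unfolding convergent_def using telescope_summable by blast
qed

lemma norm_sqrt_iter_le:
  assumes "norm B \<le> 1"
  shows "norm (sqrt_iter B n) \<le> sqrt_majorant n"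
proof (induction n)
  case (Suc n)
  have "norm (sqrt_iter B n o\<^sub>L sqrt_iter B n) \<le> sqrt_majorant n * sqrt_majorant n"
    by (intro order_trans[OF norm_blinfun_compose] mult_mono Suc sqrt_majorant_bounds) simp
  then have "norm (B + (sqrt_iter B n o\<^sub>L sqrt_iter B n)) \<le> 1 + (sqrt_majorant n)\<^sup>2"
    using assms norm_triangle_ineq[of B "sqrt_iter B n o\<^sub>L sqrt_iter B n"]
    by (simp add: power2_eq_square)
  then show ?case
    by simp
qed simp

text \<open>On the unit ball the iteration map is only known to be 1-Lipschitz, so the contraction
  principle does not apply. Instead, with D the previous increment, the difference of squares splits
  as D Y' + Y D without any commutation, and the same splitting for scalars gives exactly the
  increments of the majorant, which are summable.\<close>

lemma norm_sqrt_iter_diff_le: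
  assumes B: "norm B \<le> 1"
  shows "norm (sqrt_iter B (Suc n) - sqrt_iter B n) \<le> sqrt_majorant (Suc n) - sqrt_majorant n"
proof (induction n)
  case (Suc n)
  define Y where "Y = sqrt_iter B"
  define s where "s = sqrt_majorant"
  define D where "D = Y (Suc n) - Y n"
  have D: "norm D \<le> s (Suc n) - s n"
    using Suc by (simp add: D_def Y_def s_def)
  have "Y (Suc (Suc n)) - Y (Suc n) = (1/2) *\<^sub>R ((Y (Suc n) o\<^sub>L Y (Suc n)) - (Y n o\<^sub>L Y n))"
    unfolding Y_def sqrt_iter.simps(2)[of B "Suc n"]
    by (subst (2) sqrt_iter.simps(2)) (simp only: scaleR_diff_right scaleR_add_right add_diff_cancel_left)
  also have "(Y (Suc n) o\<^sub>L Y (Suc n)) - (Y n o\<^sub>L Y n) = (D o\<^sub>L Y (Suc n)) + (Y n o\<^sub>L D)"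
    by (simp add: D_def bounded_bilinear.diff_left[OF bounded_bilinear_blinfun_compose]
        bounded_bilinear.diff_right[OF bounded_bilinear_blinfun_compose])
  finally have eq: "Y (Suc (Suc n)) - Y (Suc n) = (1/2) *\<^sub>R ((D o\<^sub>L Y (Suc n)) + (Y n o\<^sub>L D))" .
  have "norm (D o\<^sub>L Y (Suc n)) \<le> (s (Suc n) - s n) * s (Suc n)"
    unfolding Y_def s_def
    by (intro order_trans[OF norm_blinfun_compose] mult_mono norm_sqrt_iter_le B
        D[unfolded Y_def s_def]) (auto simp: sqrt_majorant_mono simp del: sqrt_majorant.simps)
  moreover have "norm (Y n o\<^sub>L D) \<le> s n * (s (Suc n) - s n)"
    unfolding Y_def s_def
    by (intro order_trans[OF norm_blinfun_compose] mult_mono norm_sqrt_iter_le B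
        D[unfolded Y_def s_def]) (auto simp: sqrt_majorant_bounds)
  ultimately have "norm ((D o\<^sub>L Y (Suc n)) + (Y n o\<^sub>L D)) \<le> (s (Suc n))\<^sup>2 - (s n)\<^sup>2"
    by (intro order_trans[OF norm_triangle_ineq]) (simp add: power2_eq_square algebra_simps)
  also have "\<dots> = 2 * (s (Suc (Suc n)) - s (Suc n))"
    unfolding s_def sqrt_majorant.simps by (simp add: field_simps)
  finally have "norm (Y (Suc (Suc n)) - Y (Suc n)) \<le> s (Suc (Suc n)) - s (Suc n)"
    unfolding eq by simp
  then show ?case
    by (simp only: Y_def s_def)
qed (simp add: B)

lemma sqrt_iter_convergent:
  fixes B :: "'a::banach \<Rightarrow>\<^sub>L 'a"
  assumes B: "norm B \<le> 1"
  obtains Y where "sqrt_iter B \<longlonglongrightarrow> Y" "norm Y \<le> 1" "Y + Y = B + (Y o\<^sub>L Y)"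
proof -
  have "summable (\<lambda>n. sqrt_iter B (Suc n) - sqrt_iter B n)"
    by (rule summable_comparison_test'[OF summable_sqrt_majorant_diff])
      (rule norm_sqrt_iter_diff_le[OF B])
  then have "convergent (\<lambda>n. \<Sum>k<n. sqrt_iter B (Suc k) - sqrt_iter B k)"
    by (simp add: summable_iff_convergent)
  then obtain Y where lim: "sqrt_iter B \<longlonglongrightarrow> Y"
    unfolding sum_lessThan_telescope by (auto simp: convergent_def)
  have "norm Y \<le> 1"
    by (rule LIMSEQ_le_const2[OF tendsto_norm[OF lim]])
      (meson norm_sqrt_iter_le[OF B] sqrt_majorant_bounds(2) order_trans)
  moreover have "(\<lambda>n. sqrt_iter B (Suc n)) \<longlonglongrightarrow> (1/2) *\<^sub>R (B + (Y o\<^sub>L Y))"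
    unfolding sqrt_iter.simps
    by (intro tendsto_intros lim bounded_bilinear.tendsto[OF bounded_bilinear_blinfun_compose])
  then have "Y = (1/2) *\<^sub>R (B + (Y o\<^sub>L Y))"
    using LIMSEQ_Suc[OF lim] LIMSEQ_unique by blast
  then have "Y + Y = B + (Y o\<^sub>L Y)"
    by (metis scaleR_half_double scaleR_add_right)
  ultimately show ?thesis
    using that lim by blast
qed

text \<open>The commutation clause is carried along for uniqueness: it makes this root commute with
  every other positive root of A.\<close>

lemma ex_positive_sqrt:
  fixes A :: "'a::chilbert_space \<Rightarrow> 'a"
  assumes A: "positive_op A"
  shows "\<exists>P. positive_op P \<and> P \<circ> P = A \<and>
    (\<forall>C. bounded_linear C \<longrightarrow> (\<forall>x. C (A x) = A (C x)) \<longrightarrow> (\<forall>x. C (P x) = P (C x)))"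
proof -
  have cA: "bounded_clinear A"
    using A by (simp add: positive_op_def)
  note [bounded_linear] = bounded_clinearD(1)[OF cA]
  \<comment> \<open>The summand 1 keeps k positive when A = 0. With B = 1 - A / k the fixed point
    satisfies (1 - Y)^2 = A / k, hence the factor \<open>sqrt k\<close> in P below.\<close>
  define k where "k = onorm A + 1"
  have k: "k > 0" "onorm A \<le> k"
    using onorm_pos_le[OF bounded_clinearD(1)[OF cA]] by (auto simp: k_def)
  define b where "b x = x - (1 / k) *\<^sub>R A x" for x
  have "bounded_linear b"
    unfolding b_def by (intro bounded_linear_intros)
  then obtain B where B: "\<And>x. blinfun_apply B x = b x"
    using bounded_linear_Blinfun_apply by metis
  \<comment> \<open>Expanding the square, the term |A x|^2 / k^2 is absorbed by one of the two
    copies of <A x, x> / k.\<close>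
  have "norm (b x) \<le> norm x" for x
  proof -
    let ?q = "Re (cinner (A x) x)"
    have "(norm (A x))\<^sup>2 \<le> k * ?q"
      using positive_op_norm_sq_le[OF A, of x] mult_right_mono[OF k(2) positive_op_cinner(2)[OF A, of x]]
      by simp
    then have "(norm (A x))\<^sup>2 / k\<^sup>2 \<le> ?q / k"
      using k by (simp add: field_simps power2_eq_square)
    moreover have "(norm (b x))\<^sup>2 = (norm x)\<^sup>2 + (norm (A x))\<^sup>2 / k\<^sup>2 - 2 * (?q / k)"
      unfolding b_def norm_diff_sq
      by (simp add: cinner_simps Re_cinner_commute[of x] power_divide)
    ultimately have "(norm (b x))\<^sup>2 \<le> (norm x)\<^sup>2"
      using divide_nonneg_pos[OF positive_op_cinner(2)[OF A, of x] k(1)] by simp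
    then show ?thesis
      by (rule power2_le_imp_le) simp
  qed
  then have "norm B \<le> 1"
    by (intro norm_blinfun_bound) (simp_all add: B)
  then obtain Y where lim: "sqrt_iter B \<longlonglongrightarrow> Y" and nY: "norm Y \<le> 1"
    and fixp: "Y + Y = B + (Y o\<^sub>L Y)"
    by (rule sqrt_iter_convergent)
  have limx: "(\<lambda>n. sqrt_iter B n x) \<longlonglongrightarrow> Y x" for x
    by (intro tendsto_intros lim)
  have bA: "C (b x) = b (C x)" if "bounded_linear C" "\<And>x. C (A x) = A (C x)" for C x
    using that linear_simps[of C] by (simp add: b_def)
  \<comment> \<open>Commutation with A passes to B, by induction to every iterate, and by continuity
    of C to the limit.\<close>
  have comm: "C (Y x) = Y (C x)" if C: "bounded_linear C" and CA: "\<And>x. C (A x) = A (C x)" for C x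
  proof -
    have "C (sqrt_iter B n x) = sqrt_iter B n (C x)" for n x
    proof (induction n arbitrary: x)
      case (Suc n)
      then show ?case
        using linear_simps[OF C] by (simp add: blinfun.add_left blinfun.scaleR_left B bA[OF C CA])
    qed (use linear_simps[OF C] in simp)
    then have "(\<lambda>n. sqrt_iter B n (C x)) \<longlonglongrightarrow> C (Y x)"
      using bounded_linear.tendsto[OF C limx] by simp
    then show ?thesis
      using limx LIMSEQ_unique by blast
  qed
  have "cinner (sqrt_iter B n x) y = cinner x (sqrt_iter B n y)" for n x y
    by (induction n arbitrary: x y)
      (simp_all add: blinfun.add_left blinfun.scaleR_left B b_def cinner_simps
        positive_op_selfadjoint[OF A])
  then have Y_sa: "cinner (Y x) y = cinner x (Y y)" for x y
    by (intro LIMSEQ_unique[OF tendsto_cinner[OF limx tendsto_const]])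
      (simp add: tendsto_cinner[OF tendsto_const limx])
  define P where "P x = sqrt k *\<^sub>R (x - Y x)" for x
  have "bounded_clinear P"
    unfolding bounded_clinear_def
  proof (intro conjI allI)
    show "bounded_linear P"
      unfolding P_def by (intro bounded_linear_intros)
    show "P (c *\<^sub>C x) = c *\<^sub>C P x" for c x
      \<comment> \<open>Bounded functions of type \<open>blinfun\<close> are only real linear.
        Complex linearity of Y is its commutation with multiplication by c, which commutes with
        A.\<close>
      using comm[OF bounded_linear_scaleC, of c x] bounded_clinearD(2)[OF cA]
      by (simp add: P_def linear_simps[OF bounded_linear_scaleC])
  qed
  moreover have "cinner (P x) x \<in> \<real>\<^sub>\<ge>\<^sub>0" for x
  proof -
    \<comment> \<open>Y is a self-adjoint contraction, so <Y x, x> is real and at most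
      |x|^2.\<close>
    have "norm (Y x) \<le> norm x"
      using norm_blinfun[of Y x] mult_right_mono[OF nY, of "norm x"] by simp
    then have "cmod (cinner (Y x) x) \<le> norm x * norm x"
      by (intro order_trans[OF cinner_Cauchy_Schwarz] mult_right_mono) simp_all
    then have "Re (cinner (Y x) x) \<le> (norm x)\<^sup>2"
      using complex_Re_le_cmod[of "cinner (Y x) x"] by (simp add: power2_eq_square)
    moreover have "Im (cinner (Y x) x) = 0"
      using arg_cong[OF cinner_commute[of x "Y x"], of Im] Y_sa[of x x] by simp
    ultimately show ?thesis
      using k by (simp add: P_def cinner_simps cinner_self complex_nonneg_Reals_iff)
  qed
  moreover have "P (P x) = A x" for x
  proof -
    have "Y x + Y x = b x + Y (Y x)"
      using arg_cong[OF fixp, of "\<lambda>F. blinfun_apply F x"] by (simp add: blinfun.add_left B)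
    then have "x - Y x - (Y x - Y (Y x)) = (1 / k) *\<^sub>R A x"
      by (simp add: b_def algebra_simps)
    moreover have "P (P x) = k *\<^sub>R (x - Y x - (Y x - Y (Y x)))"
      using k by (simp add: P_def blinfun.scaleR_right blinfun.diff_right scaleR_diff_right)
    ultimately show ?thesis
      using k by simp
  qed
  moreover have "C (P x) = P (C x)" if "bounded_linear C" "\<forall>x. C (A x) = A (C x)" for C x
    using comm[of C x] that linear_simps[of C] by (simp add: P_def)
  ultimately show ?thesis
    by (intro exI[of _ P]) (auto simp: positive_op_def fun_eq_iff)
qed

text \<open>With y = (P - Q) x, commutation gives (P + Q) y = (P^2 - Q^2) x = 0. Both nonnegative
  forms then vanish at y, so P y = Q y = 0, and |y|^2 = <x, (P - Q) y> = 0.\<close>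

lemma positive_sqrt_unique:
  assumes P: "positive_op P" and Q: "positive_op Q"
    and sq: "P \<circ> P = Q \<circ> Q" and comm: "\<And>x. Q (P x) = P (Q x)"
  shows "P = Q"
proof
  fix x
  have cP: "bounded_clinear P" and cQ: "bounded_clinear Q"
    using P Q by (auto simp: positive_op_def)
  have sq': "P (P z) = Q (Q z)" for z
    using fun_cong[OF sq, of z] by simp
  define y where "y = P x - Q x"
  have "P y + Q y = 0"
    by (simp add: y_def bounded_clinearD[OF cP] bounded_clinearD[OF cQ] sq' comm)
  then have "Re (cinner (P y) y) + Re (cinner (Q y) y) = 0"
    by (metis cinner_add_left cinner_zero_left plus_complex.sel(1) zero_complex.sel(1))
  then have "Re (cinner (P y) y) = 0" "Re (cinner (Q y) y) = 0"
    using positive_op_cinner(2)[OF P, of y] positive_op_cinner(2)[OF Q, of y] by linarith+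
  then have "P y = 0" "Q y = 0"
    using positive_op_norm_sq_le[OF P, of y] positive_op_norm_sq_le[OF Q, of y] by simp_all
  then have "cinner (P x) y = 0" "cinner (Q x) y = 0"
    by (simp_all add: positive_op_selfadjoint[OF P] positive_op_selfadjoint[OF Q])
  then have "cinner (P x - Q x) y = 0"
    by (simp add: cinner_diff_left)
  then have "cinner y y = 0"
    by (simp add: y_def)
  then show "P x = Q x"
    by (simp add: cinner_eq_zero_iff y_def)
qed

lemma sqrt_op:
  assumes A: "positive_op A"
  shows "positive_op (sqrt_op A)" "sqrt_op A \<circ> sqrt_op A = A"
proof -
  obtain P where P: "positive_op P" "P \<circ> P = A"
    and comm: "\<And>C x. bounded_linear C \<Longrightarrow> (\<And>x. C (A x) = A (C x)) \<Longrightarrow> C (P x) = P (C x)"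
    using ex_positive_sqrt[OF A] by blast
  have "\<exists>!P. positive_op P \<and> P \<circ> P = A"
  proof (rule ex1I[of _ P])
    fix Q
    assume Q: "positive_op Q \<and> Q \<circ> Q = A"
    \<comment> \<open>Q commutes with A because A = Q^2, hence with P.\<close>
    then have "Q (P x) = P (Q x)" for x
      by (intro comm) (auto simp: positive_op_def bounded_clinear_def)
    then show "Q = P"
      using P Q positive_sqrt_unique[of P Q] by auto
  qed (use P in auto)
  from theI'[OF this] show "positive_op (sqrt_op A)" "sqrt_op A \<circ> sqrt_op A = A"
    unfolding sqrt_op_def by blast+
qed

text \<open>The norm identity is <|T|^2 x, x> = <T* T x, x>. It makes |T| x -> T x a well-defined
  isometry, the germ of the polar factor.\<close>

lemma positive_op_abs_op:
  assumes T: "bounded_clinear T"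
  shows "positive_op (abs_op T)" and norm_abs_op: "norm (abs_op T x) = norm (T x)"
proof -
  have cT: "cinner (cadjoint T (T x)) y = cinner (T x) (T y)" for x y
    by (metis cinner_cadjoint[OF T] cinner_commute)
  have "positive_op (cadjoint T \<circ> T)"
    unfolding positive_op_def bounded_clinear_def
    using bounded_linear_compose[OF bounded_clinearD(1)[OF bounded_clinear_cadjoint[OF T]]
        bounded_clinearD(1)[OF T]]
    by (auto simp: o_def bounded_clinearD[OF T] bounded_clinearD[OF bounded_clinear_cadjoint[OF T]]
        cT cinner_ge_zero)
  note root = sqrt_op[OF this, folded abs_op_def]
  show pos: "positive_op (abs_op T)"
    by (rule root)
  have "cinner (abs_op T x) (abs_op T x) = cinner (T x) (T x)"
    using fun_cong[OF root(2), of x] cT[of x x] positive_op_selfadjoint[OF pos, of "abs_op T x" x]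
    by simp
  then show "norm (abs_op T x) = norm (T x)"
    by (simp add: norm_eq_sqrt_cinner)
qed

section \<open>Polar decomposition\<close>

text \<open>The splitting of the space into the kernel of P and the closure of its range, stated
  with sequences because the polar factor is obtained by passing to limits along
  \<open>P (X n)\<close>.\<close>

lemma selfadjoint_range_decomposition:
  fixes P :: "'a::chilbert_space \<Rightarrow> 'a"
  assumes P: "bounded_clinear P" and sa: "\<And>x y. cinner (P x) y = cinner x (P y)"
  shows "\<exists>X k. P k = 0 \<and> (\<lambda>n. P (X n)) \<longlonglongrightarrow> w - k"
proof -
  let ?M = "closure (range P)"
  have mem: "y \<in> ?M \<longleftrightarrow> (\<exists>X. (\<lambda>n. P (X n)) \<longlonglongrightarrow> y)" for y
  proof
    assume "y \<in> ?M"
    then obtain Y where Y: "\<forall>n. Y n \<in> range P" "Y \<longlonglongrightarrow> y"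
      unfolding closure_sequential by blast
    have "\<forall>n. \<exists>x. Y n = P x"
      using Y(1) by auto
    from choice[OF this] obtain X where "\<forall>n. Y n = P (X n)" ..
    then have "Y = (\<lambda>n. P (X n))"
      by (simp add: fun_eq_iff)
    with Y(2) show "\<exists>X. (\<lambda>n. P (X n)) \<longlonglongrightarrow> y"
      by auto
  next
    assume "\<exists>X. (\<lambda>n. P (X n)) \<longlonglongrightarrow> y"
    then obtain X where "(\<lambda>n. P (X n)) \<longlonglongrightarrow> y" ..
    then show "y \<in> ?M"
      unfolding closure_sequential by (intro exI[of _ "\<lambda>n. P (X n)"] conjI) auto
  qed
  have "x + y \<in> ?M" if x: "x \<in> ?M" and y: "y \<in> ?M" for x y
  proof -
    obtain X where X: "(\<lambda>n. P (X n)) \<longlonglongrightarrow> x"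
      using x[unfolded mem] ..
    obtain Y where Y: "(\<lambda>n. P (Y n)) \<longlonglongrightarrow> y"
      using y[unfolded mem] ..
    from X Y have "(\<lambda>n. P (X n + Y n)) \<longlonglongrightarrow> x + y"
      unfolding bounded_clinearD[OF P] by (rule tendsto_add)
    then show ?thesis
      unfolding mem by (rule exI[where x = "\<lambda>n. X n + Y n"])
  qed
  moreover have "c *\<^sub>C x \<in> ?M" if x: "x \<in> ?M" for c x
  proof -
    obtain X where "(\<lambda>n. P (X n)) \<longlonglongrightarrow> x"
      using x[unfolded mem] ..
    then have "(\<lambda>n. P (c *\<^sub>C X n)) \<longlonglongrightarrow> c *\<^sub>C x"
      unfolding bounded_clinearD[OF P] by (rule bounded_linear.tendsto[OF bounded_linear_scaleC])
    then show ?thesis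
      unfolding mem by (rule exI[where x = "\<lambda>n. c *\<^sub>C X n"])
  qed
  moreover have "0 \<in> ?M"
    using closure_subset[of "range P"] bounded_clinearD(6)[OF P] by (metis rangeI subsetD)
  ultimately obtain y where y: "y \<in> ?M" and orth: "\<And>z. z \<in> ?M \<Longrightarrow> cinner (w - y) z = 0"
    using ex_orthogonal_projection[of ?M w] by auto
  \<comment> \<open>Orthogonality of w - y to this vector of the range reads |P (w - y)|^2 =
    0.\<close>
  have "P (P (w - y)) \<in> ?M"
    by (rule subsetD[OF closure_subset]) simp
  from orth[OF this] have "cinner (P (w - y)) (P (w - y)) = 0"
    by (simp only: sa)
  then have "P (w - y) = 0"
    by (simp only: cinner_eq_zero_iff)
  moreover obtain X where "(\<lambda>n. P (X n)) \<longlonglongrightarrow> y"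
    using y[unfolded mem] ..
  ultimately show ?thesis
    by (intro exI[of _ X] exI[of _ "w - y"]) simp
qed

text \<open>The graph of \<open>U\<close> is the closure of the pairs \<open>(P x, T x)\<close>, extended by zero on the kernel
  of \<open>P\<close>.\<close>

lemma ex_polar_isometry:
  fixes T P :: "'a::chilbert_space \<Rightarrow> 'a"
  assumes T: "bounded_clinear T" and P: "bounded_clinear P"
    and sa: "\<And>x y. cinner (P x) y = cinner x (P y)"
    and nrm: "\<And>x. norm (P x) = norm (T x)"
  shows "\<exists>U. partial_isometry U \<and> T = U \<circ> P \<and> null_space U = null_space T \<and>
    (\<forall>x. norm (U x) \<le> norm x)"
proof -
  define R where "R w z \<longleftrightarrow> (\<exists>X k. P k = 0 \<and> (\<lambda>n. P (X n)) \<longlonglongrightarrow> w - k \<and> (\<lambda>n. T (X n)) \<longlonglongrightarrow> z)"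
    for w z
  have R_I: "R w z"
    if "P k = 0" "(\<lambda>n. P (X n)) \<longlonglongrightarrow> w - k" "(\<lambda>n. T (X n)) \<longlonglongrightarrow> z" for w z k X
    unfolding R_def by (rule exI[of _ X], rule exI[of _ k], intro conjI that)
  have R_ex: "\<exists>z. R w z" for w
  proof -
    obtain X k where Pk: "P k = 0" and lim: "(\<lambda>n. P (X n)) \<longlonglongrightarrow> w - k"
      using selfadjoint_range_decomposition[OF P sa] by blast
    \<comment> \<open>Equal norms of P and T transfer the Cauchy property from
      \<open>P (X n)\<close> to \<open>T (X n)\<close>; completeness supplies the value at
      w.\<close>
    have "dist (T (X m)) (T (X n)) = dist (P (X m)) (P (X n))" for m n
      using nrm[of "X m - X n"] by (simp add: dist_norm bounded_clinearD[OF P] bounded_clinearD[OF T])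
    then have "Cauchy (\<lambda>n. T (X n))"
      using LIMSEQ_imp_Cauchy[OF lim] by (simp add: Cauchy_def)
    then show ?thesis
      using R_I[OF Pk lim] by (metis Cauchy_convergent convergent_def)
  qed
  have R_add: "R (w + w') (z + z')" if R: "R w z" and R': "R w' z'" for w w' z z'
  proof -
    obtain X k where X: "P k = 0" "(\<lambda>n. P (X n)) \<longlonglongrightarrow> w - k" "(\<lambda>n. T (X n)) \<longlonglongrightarrow> z"
      using R unfolding R_def by blast
    obtain X' k' where X': "P k' = 0" "(\<lambda>n. P (X' n)) \<longlonglongrightarrow> w' - k'" "(\<lambda>n. T (X' n)) \<longlonglongrightarrow> z'"
      using R' unfolding R_def by blast
    have "P (k + k') = 0"
      using X X' by (simp add: bounded_clinearD[OF P])
    moreover have "(\<lambda>n. P (X n + X' n)) \<longlonglongrightarrow> (w + w') - (k + k')"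
      using tendsto_add[OF X(2) X'(2)] by (simp add: bounded_clinearD[OF P] algebra_simps)
    moreover have "(\<lambda>n. T (X n + X' n)) \<longlonglongrightarrow> z + z'"
      using tendsto_add[OF X(3) X'(3)] by (simp add: bounded_clinearD[OF T])
    ultimately show ?thesis
      by (rule R_I)
  qed
  have R_scale: "R (c *\<^sub>C w) (c *\<^sub>C z)" if R: "R w z" for c w z
  proof -
    obtain X k where X: "P k = 0" "(\<lambda>n. P (X n)) \<longlonglongrightarrow> w - k" "(\<lambda>n. T (X n)) \<longlonglongrightarrow> z"
      using R unfolding R_def by blast
    note scale = bounded_linear.tendsto[OF bounded_linear_scaleC[of c]]
    have "P (c *\<^sub>C k) = 0"
      using X by (simp add: bounded_clinearD[OF P] linear_simps[OF bounded_linear_scaleC])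
    moreover have "(\<lambda>n. P (c *\<^sub>C X n)) \<longlonglongrightarrow> c *\<^sub>C w - c *\<^sub>C k"
      using scale[OF X(2)]
      by (simp add: bounded_clinearD[OF P] linear_simps[OF bounded_linear_scaleC])
    moreover have "(\<lambda>n. T (c *\<^sub>C X n)) \<longlonglongrightarrow> c *\<^sub>C z"
      using scale[OF X(3)] by (simp add: bounded_clinearD[OF T])
    ultimately show ?thesis
      by (rule R_I)
  qed
  have R_norm: "\<exists>k. P k = 0 \<and> cinner (w - k) k = 0 \<and> norm z = norm (w - k)" if R: "R w z" for w z
  proof -
    obtain X k where X: "P k = 0" "(\<lambda>n. P (X n)) \<longlonglongrightarrow> w - k" "(\<lambda>n. T (X n)) \<longlonglongrightarrow> z"
      using R unfolding R_def by blast
    have "(\<lambda>n. cinner (P (X n)) k) \<longlonglongrightarrow> cinner (w - k) k"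
      by (intro tendsto_intros X)
    then have "cinner (w - k) k = 0"
      by (simp add: sa X(1) LIMSEQ_const_iff)
    moreover have "(\<lambda>n. norm (T (X n))) \<longlonglongrightarrow> norm (w - k)"
      using tendsto_norm[OF X(2)] by (simp add: nrm)
    then have "norm z = norm (w - k)"
      using LIMSEQ_unique[OF tendsto_norm[OF X(3)]] by blast
    ultimately show ?thesis
      using X by blast
  qed
  have R_le: "norm z \<le> norm w" if R: "R w z" for w z
  proof -
    obtain k where k: "cinner (w - k) k = 0" "norm z = norm (w - k)"
      using R_norm[OF R] by blast
    then have "(norm w)\<^sup>2 = (norm z)\<^sup>2 + (norm k)\<^sup>2"
      using norm_add_sq[of "w - k" k] by simp
    then have "(norm z)\<^sup>2 \<le> (norm w)\<^sup>2"
      by simp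
    then show ?thesis
      by (rule power2_le_imp_le) simp
  qed
  have R_unique: "z = z'" if R: "R w z" "R w z'" for w z z'
  proof -
    \<comment> \<open>R is a linear relation, so two values at w give the pair (0, z - z'), and
      \<open>R_le\<close> makes the second entry vanish.\<close>
    have "R (w + (-1) *\<^sub>C w) (z + (-1) *\<^sub>C z')"
      by (intro R_add R_scale R)
    moreover have "(-1) *\<^sub>C v = - v" for v :: 'a
      using scaleR_scaleC[of "-1" v] by simp
    ultimately have "R 0 (z - z')"
      by simp
    from R_le[OF this] show ?thesis
      by simp
  qed
  obtain U where RU: "\<And>w. R w (U w)"
    using R_ex by metis
  have U_eq: "U w = z" if "R w z" for w z
    using R_unique RU that by blast
  have U_le: "norm (U w) \<le> norm w" for w
    by (rule R_le[OF RU])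
  have U: "bounded_clinear U"
    unfolding bounded_clinear_def
  proof (intro conjI allI)
    show scale: "U (c *\<^sub>C x) = c *\<^sub>C U x" for c x
      by (rule U_eq) (rule R_scale[OF RU])
    show "bounded_linear U"
    proof (rule bounded_linear_intro)
      show "U (x + y) = U x + U y" for x y
        by (rule U_eq) (rule R_add[OF RU RU])
      show "U (r *\<^sub>R x) = r *\<^sub>R U x" for r x
        by (simp only: scaleR_scaleC scale)
      show "norm (U x) \<le> norm x * 1" for x
        using U_le[of x] by simp
    qed
  qed
  have ker: "P k = 0 \<longleftrightarrow> T k = 0" for k
    using nrm[of k] by (metis norm_eq_zero)
  have U_ker: "U k = 0" if "P k = 0" for k
    using that bounded_clinearD(6)[OF P] bounded_clinearD(6)[OF T]
    by (intro U_eq R_I[of k "\<lambda>n. 0"]) simp_all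
  have ker_U: "P w = 0" if w: "U w = 0" for w
  proof -
    obtain k where "P k = 0" "norm (U w) = norm (w - k)"
      using R_norm[OF RU] by blast
    with w show ?thesis
      by simp
  qed
  have null: "null_space U = null_space T"
    unfolding null_space_def using U_ker ker_U ker by blast
  have "norm (U w) = norm w" if w: "w \<in> corthogonal (null_space U)" for w
  proof -
    obtain k where k: "P k = 0" "cinner (w - k) k = 0" "norm (U w) = norm (w - k)"
      using R_norm[OF RU] by blast
    \<comment> \<open>Both w and w - k are orthogonal to k, so k = 0 and the norm of U w is that of
      w.\<close>
    have "cinner w k = 0"
      using w U_ker[OF k(1)] by (auto simp: corthogonal_def null_space_def)
    with k(2) have "k = 0"
      by (simp add: cinner_diff_left cinner_eq_zero_iff)
    with k(3) show ?thesis
      by simp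
  qed
  then have "partial_isometry U"
    using U by (simp add: partial_isometry_def)
  moreover have "U (P x) = T x" for x
    using bounded_clinearD(6)[OF P] by (intro U_eq R_I[of 0 "\<lambda>n. x"]) simp_all
  then have "T = U \<circ> P"
    by auto
  ultimately show ?thesis
    using null U_le by blast
qed

text \<open>U and V agree on the range of P, by continuity on its closure, and both vanish on the
  kernel of P; these two subspaces span everything.\<close>

lemma polar_factor_unique:
  fixes T P :: "'a::chilbert_space \<Rightarrow> 'a"
  assumes P: "bounded_clinear P" and sa: "\<And>x y. cinner (P x) y = cinner x (P y)"
    and ker: "\<And>x. P x = 0 \<Longrightarrow> T x = 0"
    and U: "bounded_clinear U" "T = U \<circ> P" "null_space U = null_space T"
    and V: "bounded_clinear V" "T = V \<circ> P" "null_space V = null_space T"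
  shows "U = V"
proof
  fix w
  obtain X k where Pk: "P k = 0" and lim: "(\<lambda>n. P (X n)) \<longlonglongrightarrow> w - k"
    using selfadjoint_range_decomposition[OF P sa] by blast
  have "U k = 0" "V k = 0"
    using ker[OF Pk] U(3) V(3) by (auto simp: null_space_def)
  have "(\<lambda>n. T (X n)) \<longlonglongrightarrow> U (w - k)"
    using bounded_linear.tendsto[OF bounded_clinearD(1)[OF U(1)] lim] fun_cong[OF U(2)] by simp
  moreover have "(\<lambda>n. T (X n)) \<longlonglongrightarrow> V (w - k)"
    using bounded_linear.tendsto[OF bounded_clinearD(1)[OF V(1)] lim] fun_cong[OF V(2)] by simp
  ultimately have "U (w - k) = V (w - k)"
    by (rule LIMSEQ_unique)
  then show "U w = V w"
    using \<open>U k = 0\<close> \<open>V k = 0\<close> by (simp add: bounded_clinearD[OF U(1)] bounded_clinearD[OF V(1)])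
qed

lemma polar_isometry:
  assumes T: "bounded_clinear T"
  shows "partial_isometry (polar_isometry T)" "T = polar_isometry T \<circ> abs_op T"
    "null_space (polar_isometry T) = null_space T" "norm (polar_isometry T x) \<le> norm x"
proof -
  let ?P = "abs_op T"
  have P: "bounded_clinear ?P" and sa: "\<And>x y. cinner (?P x) y = cinner x (?P y)"
    using positive_op_abs_op[OF T] positive_op_selfadjoint by (auto simp: positive_op_def)
  obtain U where U: "partial_isometry U" "T = U \<circ> ?P" "null_space U = null_space T"
    and U_le: "\<And>x. norm (U x) \<le> norm x"
    using ex_polar_isometry[OF T P sa norm_abs_op[OF T]] by blast
  have ker: "T x = 0" if "?P x = 0" for x
    using norm_abs_op[OF T, of x] that by simp
  have "polar_isometry T = U"
    unfolding polar_isometry_def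
  proof (rule the_equality)
    fix V
    assume V: "partial_isometry V \<and> T = V \<circ> ?P \<and> null_space V = null_space T"
    show "V = U"
      by (rule polar_factor_unique[OF P sa ker])
        (use U V in \<open>auto simp: partial_isometry_def\<close>)
  qed (use U in blast)
  then show "partial_isometry (polar_isometry T)" "T = polar_isometry T \<circ> abs_op T"
    "null_space (polar_isometry T) = null_space T" "norm (polar_isometry T x) \<le> norm x"
    using U U_le by auto
qed

lemma bounded_clinear_compose:
  assumes "bounded_clinear S" "bounded_clinear T"
  shows "bounded_clinear (S \<circ> T)"
  using assms bounded_linear_compose[of S T] by (simp add: bounded_clinear_def o_def)

lemma bounded_clinear_duggal_transform:
  assumes T: "bounded_clinear T"
  shows "bounded_clinear (duggal_transform T)"
  using positive_op_abs_op[OF T] polar_isometry(1)[OF T]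
  unfolding duggal_transform_def positive_op_def partial_isometry_def
  by (intro bounded_clinear_compose) auto

section \<open>Numerical radius\<close>

lemma bdd_above_numerical_range:
  assumes A: "bounded_clinear A"
  shows "bdd_above (insert 0 {cmod (cinner (A x) x) | x. norm x = 1})"
proof -
  have "cmod (cinner (A x) x) \<le> onorm A" if "norm x = 1" for x
    using cinner_Cauchy_Schwarz[of "A x" x] onorm[OF bounded_clinearD(1)[OF A], of x] that by simp
  then show ?thesis
    by (intro bdd_aboveI[of _ "onorm A"]) (auto simp: onorm_pos_le[OF bounded_clinearD(1)[OF A]])
qed

lemma numerical_radius_ge_zero:
  assumes A: "bounded_clinear A"
  shows "numerical_radius A \<ge> 0"
  unfolding numerical_radius_def by (intro cSup_upper bdd_above_numerical_range A) simp

lemma cmod_cinner_le_numerical_radius: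
  assumes A: "bounded_clinear A"
  shows "cmod (cinner (A x) x) \<le> numerical_radius A * (norm x)\<^sup>2"
proof (cases "x = 0")
  case False
  define u where "u = inverse (norm x) *\<^sub>R x"
  have "norm u = 1"
    using False by (simp add: u_def)
  then have "cmod (cinner (A u) u) \<le> numerical_radius A"
    unfolding numerical_radius_def by (intro cSup_upper bdd_above_numerical_range A) auto
  moreover have "x = norm x *\<^sub>R u"
    using False by (simp add: u_def)
  then have "cinner (A x) x = of_real ((norm x)\<^sup>2) * cinner (A u) u"
    by (metis bounded_clinearD(5)[OF A] cinner_scaleR_left cinner_scaleR_right mult.assoc
        of_real_mult power2_eq_square)
  then have "cmod (cinner (A x) x) = (norm x)\<^sup>2 * cmod (cinner (A u) u)"
    by (simp only: norm_mult norm_of_real) simp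
  ultimately show ?thesis
    by (simp add: mult.commute[of "(norm x)\<^sup>2"] mult_right_mono)
qed simp

lemma numerical_radius_le:
  assumes "c \<ge> 0" "\<And>x. norm x = 1 \<Longrightarrow> cmod (cinner (A x) x) \<le> c"
  shows "numerical_radius A \<le> c"
  unfolding numerical_radius_def by (intro cSup_least) (use assms in auto)

lemma numerical_radius_sequence:
  assumes A: "bounded_clinear A" and pos: "numerical_radius A > 0"
  obtains X where "\<And>n. norm (X n) = 1"
    "(\<lambda>n. cmod (cinner (A (X n)) (X n))) \<longlonglongrightarrow> numerical_radius A"
proof -
  let ?w = "numerical_radius A"
  \<comment> \<open>The gap is proportional to the radius so that the threshold stays nonnegative,
    as \<open>numerical_radius_le\<close> demands; at n = 0 it is 0.\<close>
  have "\<exists>x. norm x = 1 \<and> ?w - ?w * inverse (real (Suc n)) < cmod (cinner (A x) x)" for n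
  proof (rule ccontr)
    assume "\<not> ?thesis"
    then have "?w \<le> ?w - ?w * inverse (real (Suc n))"
      using pos by (intro numerical_radius_le) (auto simp: field_simps not_less)
    moreover have "?w * inverse (real (Suc n)) > 0"
      using pos by simp
    ultimately show False
      by linarith
  qed
  then obtain X where X: "\<And>n. norm (X n) = 1"
    and lower: "\<And>n. ?w - ?w * inverse (real (Suc n)) < cmod (cinner (A (X n)) (X n))"
    by metis
  have "(\<lambda>n. ?w - ?w * inverse (real (Suc n))) \<longlonglongrightarrow> ?w - ?w * 0"
    by (intro tendsto_intros LIMSEQ_inverse_real_of_nat)
  then have lower_lim: "(\<lambda>n. ?w - ?w * inverse (real (Suc n))) \<longlonglongrightarrow> ?w"
    by simp
  have upper: "cmod (cinner (A (X n)) (X n)) \<le> ?w" for n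
    using cmod_cinner_le_numerical_radius[OF A, of "X n"] X by simp
  have "(\<lambda>n. cmod (cinner (A (X n)) (X n))) \<longlonglongrightarrow> ?w"
    by (rule tendsto_sandwich[OF _ _ lower_lim tendsto_const])
      (use lower upper in \<open>auto intro!: always_eventually less_imp_le\<close>)
  with X show ?thesis
    by (rule that)
qed

section \<open>Norms of sums\<close>

lemma cinner_cadjoint_compose:
  assumes "bounded_clinear A"
  shows "cinner ((cadjoint A \<circ> B) x) x = cinner (B x) (A x)"
  unfolding o_def by (metis cinner_cadjoint[OF assms] cinner_commute)

lemma norm_lincomb_sq:
  "(norm (a *\<^sub>R x + b *\<^sub>R y))\<^sup>2 = (a * norm x)\<^sup>2 + (b * norm y)\<^sup>2 + 2 * a * b * Re (cinner y x)"
  for x y :: "'a::complex_inner"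
  by (simp add: norm_add_sq cinner_simps power_mult_distrib Re_cinner_commute[of x y])

lemma numerical_radius_adjoint_le:
  assumes A: "bounded_clinear A" and B: "bounded_clinear B"
  shows "numerical_radius (cadjoint A \<circ> B) \<le> onorm A * onorm B"
proof (rule numerical_radius_le)
  note pos = onorm_pos_le[OF bounded_clinearD(1)[OF A]] onorm_pos_le[OF bounded_clinearD(1)[OF B]]
  show "0 \<le> onorm A * onorm B"
    using pos by simp
  show "cmod (cinner ((cadjoint A \<circ> B) x) x) \<le> onorm A * onorm B" if x: "norm x = 1" for x
  proof -
    have "cmod (cinner (B x) (A x)) \<le> norm (B x) * norm (A x)"
      by (rule cinner_Cauchy_Schwarz)
    also have "\<dots> \<le> onorm B * onorm A"
      using onorm[OF bounded_clinearD(1)[OF A], of x] onorm[OF bounded_clinearD(1)[OF B], of x] x pos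
      by (intro mult_mono) auto
    finally show ?thesis
      unfolding cinner_cadjoint_compose[OF A] by (simp add: mult.commute)
  qed
qed

text \<open>The cross term is kept as the quadratic form of A* B instead of being split by
  Cauchy-Schwarz; this is how the norm of the mean transform sees the numerical radius.\<close>

lemma onorm_lincomb_sq_le:
  assumes A: "bounded_clinear A" and B: "bounded_clinear B" and a: "a \<ge> 0" and b: "b \<ge> 0"
  shows "(onorm (\<lambda>x. a *\<^sub>R A x + b *\<^sub>R B x))\<^sup>2 \<le>
    (a * onorm A)\<^sup>2 + (b * onorm B)\<^sup>2 + 2 * a * b * numerical_radius (cadjoint A \<circ> B)"
    (is "_ \<le> ?K")
proof -
  let ?w = "numerical_radius (cadjoint A \<circ> B)"
  have C: "bounded_clinear (cadjoint A \<circ> B)"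
    by (intro bounded_clinear_compose bounded_clinear_cadjoint A B)
  have K: "?K \<ge> 0"
    using a b numerical_radius_ge_zero[OF C] by simp
  have "norm (a *\<^sub>R A x + b *\<^sub>R B x) \<le> sqrt ?K * norm x" for x
  proof -
    have "(a * norm (A x))\<^sup>2 \<le> (a * onorm A)\<^sup>2 * (norm x)\<^sup>2"
      using mult_left_mono[OF onorm[OF bounded_clinearD(1)[OF A], of x] a] a
      unfolding power_mult_distrib[symmetric] by (intro power_mono) (simp_all add: mult.assoc)
    moreover have "(b * norm (B x))\<^sup>2 \<le> (b * onorm B)\<^sup>2 * (norm x)\<^sup>2"
      using mult_left_mono[OF onorm[OF bounded_clinearD(1)[OF B], of x] b] b
      unfolding power_mult_distrib[symmetric] by (intro power_mono) (simp_all add: mult.assoc)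
    moreover have "Re (cinner (B x) (A x)) \<le> ?w * (norm x)\<^sup>2"
      using cmod_cinner_le_numerical_radius[OF C, of x] complex_Re_le_cmod order_trans
      unfolding cinner_cadjoint_compose[OF A] by blast
    then have "2 * a * b * Re (cinner (B x) (A x)) \<le> 2 * a * b * (?w * (norm x)\<^sup>2)"
      using a b by (intro mult_left_mono) simp_all
    ultimately have "(norm (a *\<^sub>R A x + b *\<^sub>R B x))\<^sup>2 \<le> ?K * (norm x)\<^sup>2"
      unfolding norm_lincomb_sq by (simp add: algebra_simps)
    then have "sqrt ((norm (a *\<^sub>R A x + b *\<^sub>R B x))\<^sup>2) \<le> sqrt (?K * (norm x)\<^sup>2)"
      by (rule real_sqrt_le_mono)
    then show ?thesis
      by (simp add: real_sqrt_mult)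
  qed
  then have "onorm (\<lambda>x. a *\<^sub>R A x + b *\<^sub>R B x) \<le> sqrt ?K"
    by (rule onorm_bound[OF real_sqrt_ge_zero[OF K]])
  moreover have "bounded_linear (\<lambda>x. a *\<^sub>R A x + b *\<^sub>R B x)"
    using bounded_clinearD(1)[OF A] bounded_clinearD(1)[OF B]
    by (intro bounded_linear_add bounded_linear_const_scaleR)
  ultimately have "(onorm (\<lambda>x. a *\<^sub>R A x + b *\<^sub>R B x))\<^sup>2 \<le> (sqrt ?K)\<^sup>2"
    by (intro power_mono onorm_pos_le)
  then show ?thesis
    using K by simp
qed

lemma bounded_linear_mean_transform:
  assumes T: "bounded_clinear T"
  shows "bounded_linear (mean_transform l T)"
  unfolding mean_transform_def
  using bounded_clinearD(1)[OF T] bounded_clinearD(1)[OF bounded_clinear_duggal_transform[OF T]]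
  by (intro bounded_linear_add bounded_linear_const_scaleR)

lemma onorm_mean_transform_le:
  assumes T: "bounded_clinear T" and l: "0 \<le> l" "l \<le> 1"
  shows "onorm (mean_transform l T) \<le> l * onorm T + (1 - l) * onorm (duggal_transform T)"
proof -
  note lin = bounded_clinearD(1)[OF T] bounded_clinearD(1)[OF bounded_clinear_duggal_transform[OF T]]
  have "onorm (mean_transform l T)
      \<le> onorm (\<lambda>x. l *\<^sub>R T x) + onorm (\<lambda>x. (1 - l) *\<^sub>R duggal_transform T x)"
    unfolding mean_transform_def by (intro onorm_triangle bounded_linear_const_scaleR lin)
  then show ?thesis
    using l by (simp add: onorm_scaleR lin)
qed

text \<open>In general \<open>|\<langle>B x, A x\<rangle>|\<close> close to its maximum only gives \<open>B x \<approx> c A x\<close> for some unimodular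
  \<open>c\<close>. Here the phase is forced: if \<open>x\<close> is almost norming for \<open>T\<close>, then \<open>|T| x \<approx> \<parallel>T\<parallel> x\<close>, so
  \<open>T x \<approx> \<parallel>T\<parallel> U x\<close> and \<open>\<langle>T\<^sup>D x, T x\<rangle> \<approx> \<parallel>T\<parallel> \<langle>|T| U x, U x\<rangle> \<ge> 0\<close>.\<close>

lemma cinner_duggal_transform_phase:
  assumes T: "bounded_clinear T" and X: "\<And>n. norm (X n) = 1"
    and lim: "(\<lambda>n. norm (T (X n))) \<longlonglongrightarrow> onorm T"
  shows "\<exists>\<epsilon>. \<epsilon> \<longlonglongrightarrow> 0 \<and> (\<forall>n. Re (cinner (duggal_transform T (X n)) (T (X n))) \<ge>
    cmod (cinner (duggal_transform T (X n)) (T (X n))) - \<epsilon> n)"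
proof -
  define P where "P = abs_op T"
  define U where "U = polar_isometry T"
  define D where "D = duggal_transform T"
  define N where "N = onorm T"
  have P: "positive_op P"
    unfolding P_def by (rule positive_op_abs_op[OF T])
  have cU: "bounded_clinear U"
    using polar_isometry(1)[OF T] by (simp add: U_def partial_isometry_def)
  have D_eq: "D x = P (U x)" and T_eq: "T x = U (P x)" and U_le: "norm (U x) \<le> norm x"
    and nP: "norm (P x) = norm (T x)" for x
    using polar_isometry(4)[OF T, of x] fun_cong[OF polar_isometry(2)[OF T], of x]
    by (simp_all add: D_def P_def U_def duggal_transform_def norm_abs_op[OF T])
  have onP: "onorm P = N"
    by (simp add: N_def onorm_def nP)
  have N0: "N \<ge> 0"
    unfolding N_def by (rule onorm_pos_le[OF bounded_clinearD(1)[OF T]])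
  define e where "e n = sqrt (N\<^sup>2 - (norm (T (X n)))\<^sup>2)" for n
  have "e \<longlonglongrightarrow> sqrt (N\<^sup>2 - N\<^sup>2)"
    unfolding e_def N_def by (intro tendsto_intros lim)
  then have e: "e \<longlonglongrightarrow> 0"
    by simp
  have close: "norm (T (X n) - N *\<^sub>R U (X n)) \<le> e n" for n
  proof -
    have "(norm (P (X n) - N *\<^sub>R X n))\<^sup>2
        = (norm (P (X n)))\<^sup>2 + N\<^sup>2 - 2 * (N * Re (cinner (P (X n)) (X n)))"
      unfolding norm_diff_sq by (simp add: X cinner_simps power_mult_distrib)
    \<comment> \<open>Here |P x|^2 <= N <P x, x> bounds the subtracted term below by 2 |P x|^2, and
      |P x| = |T x|.\<close>
    also have "\<dots> \<le> N\<^sup>2 - (norm (T (X n)))\<^sup>2"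
      using positive_op_norm_sq_le[OF P, of "X n"] by (simp add: onP nP)
    finally have "norm (P (X n) - N *\<^sub>R X n) \<le> e n"
      unfolding e_def by (rule real_le_rsqrt)
    moreover have "T (X n) - N *\<^sub>R U (X n) = U (P (X n) - N *\<^sub>R X n)"
      by (simp add: T_eq bounded_clinearD[OF cU])
    ultimately show ?thesis
      using U_le[of "P (X n) - N *\<^sub>R X n"] by simp
  qed
  \<comment> \<open>With c close to some q >= 0, both |c| - q and q - Re c are at most |c - q|;
    hence the factor 2.\<close>
  define \<epsilon> where "\<epsilon> n = 2 * (onorm D * e n)" for n
  have "\<epsilon> \<longlonglongrightarrow> 2 * (onorm D * 0)"
    unfolding \<epsilon>_def by (intro tendsto_intros e)
  moreover have "Re (cinner (D (X n)) (T (X n))) \<ge> cmod (cinner (D (X n)) (T (X n))) - \<epsilon> n" for n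
  proof -
    define c where "c = cinner (D (X n)) (T (X n))"
    define q where "q = N * Re (cinner (P (U (X n))) (U (X n)))"
    have q: "cinner (D (X n)) (N *\<^sub>R U (X n)) = of_real q"
      using positive_op_cinner(1)[OF P, of "U (X n)"]
      by (simp add: q_def D_eq cinner_scaleR_right)
    have q0: "q \<ge> 0"
      unfolding q_def using N0 positive_op_cinner(2)[OF P] by simp
    have "norm (D (X n)) \<le> onorm D"
      using onorm[OF bounded_clinearD(1)[OF bounded_clinear_duggal_transform[OF T]], of "X n"] X
      by (simp add: D_def)
    then have "cmod (cinner (D (X n)) (T (X n) - N *\<^sub>R U (X n))) \<le> onorm D * e n"
      by (intro order_trans[OF cinner_Cauchy_Schwarz] mult_mono close)
        (auto intro: order_trans[OF norm_ge_zero])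
    then have cq: "cmod (c - of_real q) \<le> onorm D * e n"
      by (simp only: cinner_diff_right q c_def)
    have "cmod c \<le> q + cmod (c - of_real q)"
      using norm_triangle_ineq[of "of_real q" "c - of_real q"] q0 by simp
    moreover have "q - Re c \<le> cmod (c - of_real q)"
      using abs_Re_le_cmod[of "c - of_real q"] by simp
    ultimately show ?thesis
      using cq unfolding c_def[symmetric] \<epsilon>_def by linarith
  qed
  ultimately show ?thesis
    unfolding D_def by (intro exI[of _ \<epsilon>]) simp
qed

text \<open>The product of t and d is at least p, which tends to M^2, while each of t and d is at
  most M; so both tend to M. This makes the vectors norming for T, and the phase estimate turns the
  modulus of the cross term into its real part up to a vanishing error.\<close>

lemma onorm_mean_transform_ge:
  assumes T: "bounded_clinear T" and l: "0 < l" "l < 1" and M: "M > 0"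
    and TM: "l * onorm T \<le> M" and DM: "(1 - l) * onorm (duggal_transform T) \<le> M"
    and w: "l * (1 - l) * numerical_radius (cadjoint T \<circ> duggal_transform T) = M\<^sup>2"
  shows "2 * M \<le> onorm (mean_transform l T)"
proof -
  define D where "D = duggal_transform T"
  let ?C = "cadjoint T \<circ> D"
  have D: "bounded_clinear D"
    unfolding D_def by (rule bounded_clinear_duggal_transform[OF T])
  have C: "bounded_clinear ?C"
    by (intro bounded_clinear_compose bounded_clinear_cadjoint T D)
  have "l * (1 - l) > 0"
    using l by simp
  then have wpos: "numerical_radius ?C > 0"
    using w M unfolding D_def[symmetric] by (metis zero_less_mult_pos zero_less_power)
  obtain X where X: "\<And>n. norm (X n) = 1"
    and lim: "(\<lambda>n. cmod (cinner (?C (X n)) (X n))) \<longlonglongrightarrow> numerical_radius ?C"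
    using numerical_radius_sequence[OF C wpos] by blast
  define t where "t n = l * norm (T (X n))" for n
  define d where "d n = (1 - l) * norm (D (X n))" for n
  define c where "c n = cinner (D (X n)) (T (X n))" for n
  define p where "p n = l * (1 - l) * cmod (c n)" for n
  have "p \<longlonglongrightarrow> l * (1 - l) * numerical_radius ?C"
    unfolding p_def c_def cinner_cadjoint_compose[OF T, symmetric] by (intro tendsto_intros lim)
  then have p: "p \<longlonglongrightarrow> M\<^sup>2"
    using w by (simp add: D_def)
  have p_le: "p n \<le> t n * d n" for n
  proof -
    have "p n \<le> l * (1 - l) * (norm (D (X n)) * norm (T (X n)))"
      unfolding p_def c_def using l by (intro mult_left_mono cinner_Cauchy_Schwarz) simp
    then show ?thesis
      by (simp add: t_def d_def algebra_simps)
  qed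
  have T_le: "norm (T (X n)) \<le> onorm T" for n
    using onorm[OF bounded_clinearD(1)[OF T], of "X n"] X by simp
  have D_le: "norm (D (X n)) \<le> onorm D" for n
    using onorm[OF bounded_clinearD(1)[OF D], of "X n"] X by simp
  have t_le: "t n \<le> M" for n
    unfolding t_def using l by (intro order_trans[OF mult_left_mono[OF T_le] TM]) simp
  have d_le: "d n \<le> M" for n
    unfolding d_def
    using l by (intro order_trans[OF mult_left_mono[OF D_le] DM[folded D_def]]) simp
  have t0: "t n \<ge> 0" and d0: "d n \<ge> 0" for n
    using l by (simp_all add: t_def d_def)
  have lower: "(\<lambda>n. p n / M) \<longlonglongrightarrow> M"
    using tendsto_divide[OF p tendsto_const, of M] M by (simp add: power2_eq_square)
  have "p n / M \<le> t n" for n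
    using p_le[of n] mult_left_mono[OF d_le[of n] t0[of n]] M by (simp add: field_simps)
  then have t: "t \<longlonglongrightarrow> M"
    using t_le by (intro tendsto_sandwich[OF _ _ lower tendsto_const] always_eventually allI)
  have "p n / M \<le> d n" for n
    using p_le[of n] mult_right_mono[OF t_le[of n] d0[of n]] M by (simp add: field_simps)
  then have d: "d \<longlonglongrightarrow> M"
    using d_le by (intro tendsto_sandwich[OF _ _ lower tendsto_const] always_eventually allI)
  have nT: "(\<lambda>n. norm (T (X n))) \<longlonglongrightarrow> M / l"
    using tendsto_divide[OF t tendsto_const, of l] l by (simp add: t_def)
  \<comment> \<open>M is only assumed to bound \<open>l * onorm T\<close>; the limit shows that the
    bound is attained, as the phase estimate requires.\<close>
  have "M / l \<le> onorm T"
    by (rule LIMSEQ_le_const2[OF nT]) (use T_le in blast)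
  then have "onorm T = M / l"
    using TM l by (simp add: field_simps)
  with nT have norming: "(\<lambda>n. norm (T (X n))) \<longlonglongrightarrow> onorm T"
    by simp
  obtain \<epsilon> where \<epsilon>: "\<epsilon> \<longlonglongrightarrow> 0" and phase: "\<And>n. Re (c n) \<ge> cmod (c n) - \<epsilon> n"
    using cinner_duggal_transform_phase[of T X, OF T X norming] unfolding c_def D_def by blast
  have "(t n)\<^sup>2 + (d n)\<^sup>2 + 2 * (p n - l * (1 - l) * \<epsilon> n) \<le> (onorm (mean_transform l T))\<^sup>2" for n
  proof -
    have "p n - l * (1 - l) * \<epsilon> n \<le> l * (1 - l) * Re (c n)"
      using mult_left_mono[OF phase[of n], of "l * (1 - l)"] l by (simp add: p_def algebra_simps)
    then have "(t n)\<^sup>2 + (d n)\<^sup>2 + 2 * (p n - l * (1 - l) * \<epsilon> n) \<le> (norm (mean_transform l T (X n)))\<^sup>2"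
      unfolding mean_transform_def norm_lincomb_sq t_def d_def c_def D_def by simp
    also have "\<dots> \<le> (onorm (mean_transform l T))\<^sup>2"
      using onorm[OF bounded_linear_mean_transform[OF T], of l "X n"] X by (intro power_mono) simp_all
    finally show ?thesis .
  qed
  moreover have "(\<lambda>n. (t n)\<^sup>2 + (d n)\<^sup>2 + 2 * (p n - l * (1 - l) * \<epsilon> n))
      \<longlonglongrightarrow> M\<^sup>2 + M\<^sup>2 + 2 * (M\<^sup>2 - l * (1 - l) * 0)"
    by (intro tendsto_intros t d p \<epsilon>)
  ultimately have "M\<^sup>2 + M\<^sup>2 + 2 * (M\<^sup>2 - l * (1 - l) * 0) \<le> (onorm (mean_transform l T))\<^sup>2"
    by (intro LIMSEQ_le_const2) blast+
  then have "(2 * M)\<^sup>2 \<le> (onorm (mean_transform l T))\<^sup>2"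
    by (simp add: power_mult_distrib)
  then show ?thesis
    by (rule power2_le_imp_le) (rule onorm_pos_le[OF bounded_linear_mean_transform[OF T]])
qed

theorem theorem3p12:
  fixes T :: "'a::chilbert_space \<Rightarrow> 'a" and l :: real
  assumes "bounded_clinear T" and "0 < l" and "l < 1"
  shows "onorm (mean_transform l T) = 2 * max (l * onorm T) ((1 - l) * onorm (duggal_transform T))
    \<longleftrightarrow> numerical_radius (cadjoint T \<circ> duggal_transform T) =
      1 / (l - l\<^sup>2) * max (l\<^sup>2 * (onorm T)\<^sup>2) ((1 - l)\<^sup>2 * (onorm (duggal_transform T))\<^sup>2)"
proof -
  define D where "D = duggal_transform T"
  define w where "w = numerical_radius (cadjoint T \<circ> D)"
  define M where "M = max (l * onorm T) ((1 - l) * onorm D)"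
  note T = assms(1)
  have D: "bounded_clinear D"
    unfolding D_def by (rule bounded_clinear_duggal_transform[OF T])
  note pos = onorm_pos_le[OF bounded_clinearD(1)[OF T]] onorm_pos_le[OF bounded_clinearD(1)[OF D]]
  have TM: "l * onorm T \<le> M" and DM: "(1 - l) * onorm D \<le> M"
    by (simp_all add: M_def)
  have T0: "0 \<le> l * onorm T" and D0: "0 \<le> (1 - l) * onorm D"
    using pos assms by simp_all
  have M0: "M \<ge> 0"
    using T0 TM by linarith
  have sq: "(l * onorm T)\<^sup>2 \<le> M\<^sup>2" "((1 - l) * onorm D)\<^sup>2 \<le> M\<^sup>2"
    using T0 D0 TM DM by (auto intro: power_mono)
  have max_sq: "max (l\<^sup>2 * (onorm T)\<^sup>2) ((1 - l)\<^sup>2 * (onorm D)\<^sup>2) = M\<^sup>2"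
    using sq unfolding power_mult_distrib[symmetric] by (auto simp: M_def max_def)
  have "l - l\<^sup>2 = l * (1 - l)" "l * (1 - l) \<noteq> 0"
    using assms by (simp_all add: power2_eq_square algebra_simps)
  \<comment> \<open>Condition (ii) cleared of its denominator l - l^2 = l (1 - l).\<close>
  then have radius: "w = 1 / (l - l\<^sup>2) * max (l\<^sup>2 * (onorm T)\<^sup>2) ((1 - l)\<^sup>2 * (onorm D)\<^sup>2)
      \<longleftrightarrow> l * (1 - l) * w = M\<^sup>2"
    unfolding max_sq by (simp only: eq_divide_eq times_divide_eq_left mult_1) (simp add: mult.commute)
  have upper: "onorm (mean_transform l T) \<le> 2 * M"
    using onorm_mean_transform_le[OF T, of l] assms TM DM by (simp add: D_def)
  have "onorm (mean_transform l T) = 2 * M \<longleftrightarrow> l * (1 - l) * w = M\<^sup>2"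
  proof
    assume eq: "onorm (mean_transform l T) = 2 * M"
    \<comment> \<open>Each of the first two squares is at most M^2, so of 4 M^2 at least 2 M^2 must
      come from the radius.\<close>
    have "(2 * M)\<^sup>2 \<le> (l * onorm T)\<^sup>2 + ((1 - l) * onorm D)\<^sup>2 + 2 * l * (1 - l) * w"
      using onorm_lincomb_sq_le[OF T D, of l "1 - l"] assms eq
      by (simp add: mean_transform_def D_def w_def)
    then have "M\<^sup>2 \<le> l * (1 - l) * w"
      using sq by (simp add: power_mult_distrib)
    \<comment> \<open>The reverse inequality holds for every T: M^2 is the ceiling for this
      quantity.\<close>
    moreover have "l * (1 - l) * w \<le> l * (1 - l) * (onorm T * onorm D)"
      unfolding w_def using assms by (intro mult_left_mono numerical_radius_adjoint_le T D) simp
    moreover have "(l * onorm T) * ((1 - l) * onorm D) \<le> M * M"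
      by (intro mult_mono TM DM M0 D0)
    ultimately show "l * (1 - l) * w = M\<^sup>2"
      by (simp add: power2_eq_square algebra_simps)
  next
    assume eq: "l * (1 - l) * w = M\<^sup>2"
    show "onorm (mean_transform l T) = 2 * M"
    \<comment> \<open>The sequence argument divides by M; for M = 0 the upper bound already forces
      the norm to be 0.\<close>
    proof (cases "M = 0")
      case True
      then show ?thesis
        using upper onorm_pos_le[OF bounded_linear_mean_transform[OF T], of l] by simp
    next
      case False
      then have "2 * M \<le> onorm (mean_transform l T)"
        using M0 TM DM eq assms unfolding D_def w_def by (intro onorm_mean_transform_ge) auto
      with upper show ?thesis
        by simp
    qed
  qed
  then show ?thesis
    using radius by (simp only: D_def w_def M_def)
qed

end
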